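(* Let $S=\langle a_1,\dots,a_n\rangle\subset\mathbb{N}^d$ be a $\mathcal{C}$-semigroup, minimally generated by $a_1,\dots,a_n$, such that $\mathrm{cone}(S)\cap\mathbb{N}^d=\mathbb{N}^d$. Then for any term order $\prec$ on $\mathbb{N}^d$, $$F(S)_\prec=\exp\bigl(LT_\prec\,\mathcal{K}(k[S];\mathbf{t})\bigr)-\sum_{i=1}^n a_i .$$
   Context: $\mathbb{N}$ denotes the non-negative integers. An affine semigroup $S$ is a finitely generated submonoid of $\mathbb{N}^d$, with minimal generating set $\{a_1,\dots,a_n\}$. Put $\mathrm{cone}(S)=\{\sum_{i=1}^n\lambda_i a_i\mid \lambda_i\in\mathbb{Q}_{\ge 0}\}$ and $\mathcal{H}(S)=(\mathrm{cone}(S)\setminus S)\cap\mathbb{N}^d$. The set of pseudo-Frobenius elements is $\mathrm{PF}(S)=\{f\in\mathcal{H}(S)\mid f+s\in S \text{ for all } s\in S\setminus\{0\}\}$. $S$ is an MPD-semigroup if $\mathrm{PF}(S)\neq\emptyset$. $S$ is a $\mathcal{C}$-semigroup if it is an MPD-semigroup and $\mathcal{H}(S)$ is non-empty and finite. A term order (monomial ordering) on $\mathbb{N}^d$ is a total order $\prec$ compatible with addition and with $0\prec a$ for all $a\neq 0$. The Frobenius element is $F(S)_\prec=\max_\prec\mathcal{H}(S)$ (it exists as $\mathcal{H}(S)$ is finite and non-empty). Let $k$ be a field and $k[S]=\bigoplus_{s\in S}k\,\mathbf{t}^s\subseteq k[t_1,\dots,t_d]$ with $\mathbf{t}^s=t_1^{s_1}\cdots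 t_d^{s_d}$. Its Hilbert series is $H(k[S];\mathbf{t})=\sum_{s\in S}\dim_k(k[S]_s)\,\mathbf{t}^s=\sum_{s\in S}\mathbf{t}^s$, and it can be written uniquely as $H(k[S];\mathbf{t})=\mathcal{K}(k[S];\mathbf{t})/\prod_{i=1}^n(1-\mathbf{t}^{a_i})$ with $\mathcal{K}(k[S];\mathbf{t})\in\mathbb{Z}[t_1,\dots,t_d]$ (the $K$-polynomial). For a nonzero polynomial $f=\sum_a\gamma_a\mathbf{t}^a$, $LT_\prec(f)=\gamma_b\mathbf{t}^b$ with $b=\max_\prec\{a\mid\gamma_a\neq0\}$, and $\exp(LT_\prec(f))=b$. *)

theory Defs
  imports "HOL-Analysis.Finite_Cartesian_Product" "HOL-Library.Poly_Mapping"
begin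

text \<open>
  The monoid of exponents is \<^typ>\<open>nat ^ 'd\<close>; the index type \<open>'d\<close> has \<open>d\<close> elements. The map
  \<open>of_nat_vec\<close> embeds it into \<open>rat ^ 'd\<close> (for cones) and into \<open>int ^ 'd\<close> (for subtraction, since
  subtraction on \<^typ>\<open>nat\<close> truncates).
\<close>

definition of_nat_vec :: "nat ^ 'd \<Rightarrow> 'a::semiring_1 ^ 'd" where
  "of_nat_vec x = (\<chi> i. of_nat (x $ i))"


section \<open>Affine semigroups\<close>

definition add_submonoid :: "'a::comm_monoid_add set \<Rightarrow> bool" where
  "add_submonoid M \<longleftrightarrow> 0 \<in> M \<and> (\<forall>x\<in>M. \<forall>y\<in>M. x + y \<in> M)"

definition affine_semigroup :: "(nat ^ 'd) set \<Rightarrow> bool" where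
  "affine_semigroup S \<longleftrightarrow> (\<exists>A. finite A \<and> add_submonoid hull A = S)"

definition minimal_generating_set :: "(nat ^ 'd) set \<Rightarrow> (nat ^ 'd) set \<Rightarrow> bool" where
  "minimal_generating_set A S \<longleftrightarrow>
     finite A \<and> add_submonoid hull A = S \<and> (\<forall>B. B \<subset> A \<longrightarrow> add_submonoid hull B \<noteq> S)"

text \<open>The minimal generating set of an affine semigroup is unique, see
  \<open>minimal_generators_eq\<close> below.\<close>

definition minimal_generators :: "(nat ^ 'd) set \<Rightarrow> (nat ^ 'd) set" where
  "minimal_generators S = (THE A. minimal_generating_set A S)"

definition rat_cone :: "(nat ^ 'd) set \<Rightarrow> (rat ^ 'd) set" where
  "rat_cone S =
     {\<Sum>a\<in>minimal_generators S. l a *s of_nat_vec a | l. \<forall>a\<in>minimal_generators S. 0 \<le> l a}"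

definition gaps :: "(nat ^ 'd) set \<Rightarrow> (nat ^ 'd) set" where
  "gaps S = {x. of_nat_vec x \<in> rat_cone S \<and> x \<notin> S}"

definition pseudo_Frobenius :: "(nat ^ 'd) set \<Rightarrow> (nat ^ 'd) set" where
  "pseudo_Frobenius S = {f \<in> gaps S. \<forall>s\<in>S - {0}. f + s \<in> S}"

definition MPD_semigroup :: "(nat ^ 'd) set \<Rightarrow> bool" where
  "MPD_semigroup S \<longleftrightarrow> affine_semigroup S \<and> pseudo_Frobenius S \<noteq> {}"

definition C_semigroup :: "(nat ^ 'd) set \<Rightarrow> bool" where
  "C_semigroup S \<longleftrightarrow> MPD_semigroup S \<and> gaps S \<noteq> {} \<and> finite (gaps S)"

lemma add_submonoid_hull: "add_submonoid (add_submonoid hull A)"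
  by (rule hull_in) (auto simp: add_submonoid_def)

lemma minimal_generating_set_irreducibles:
  assumes "minimal_generating_set A S"
  shows "A = {x \<in> S - {0}. \<forall>y\<in>S. \<forall>z\<in>S. x = y + z \<longrightarrow> y = 0 \<or> z = 0}" (is "A = ?I")
proof -
  have S: "add_submonoid hull A = S" and min: "\<And>B. B \<subset> A \<Longrightarrow> add_submonoid hull B \<noteq> S"
    using assms by (auto simp: minimal_generating_set_def)
  have subS: "add_submonoid S" using add_submonoid_hull[of A] S by simp
  have AS: "A \<subseteq> S" using S hull_subset by metis
  show ?thesis
  proof
    show "A \<subseteq> ?I"
    proof
      fix a assume a: "a \<in> A"
      define T where "T = add_submonoid hull (A - {a})"
      have T: "add_submonoid T" "A - {a} \<subseteq> T"
        unfolding T_def by (rule add_submonoid_hull) (rule hull_subset)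
      have aT: "a \<notin> T"
      proof
        assume "a \<in> T"
        then have "A \<subseteq> T" using T(2) by auto
        then have "S \<subseteq> T" using hull_minimal[of A T add_submonoid] T(1) S by simp
        moreover have "T \<subseteq> S" unfolding T_def S[symmetric] by (rule hull_mono) auto
        ultimately have "T = S" by simp
        then show False using min[of "A - {a}"] a unfolding T_def by auto
      qed
      have a0: "a \<noteq> 0" using aT T(1) by (auto simp: add_submonoid_def)
      have "S \<subseteq> {x. x \<in> T \<or> (\<exists>w. x = a + w)}"
        unfolding S[symmetric]
      proof (rule hull_minimal)
        show "A \<subseteq> {x. x \<in> T \<or> (\<exists>w. x = a + w)}"
          using T(2) by (auto intro: exI[of _ 0])
        show "add_submonoid {x. x \<in> T \<or> (\<exists>w. x = a + w)}"
          using T(1) unfolding add_submonoid_def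
          by (safe; simp) (metis add.assoc add.left_commute)+
      qed
      moreover have "u = a + w \<Longrightarrow> a = u + v \<Longrightarrow> v = 0" for u v w :: "nat ^ 'a"
        by (auto simp: vec_eq_iff)
      ultimately have key: "y \<in> T \<or> z = 0" if "y \<in> S" "a = y + z" for y z
        using that by blast
      have "y = 0 \<or> z = 0" if "y \<in> S" "z \<in> S" "a = y + z" for y z
      proof (rule ccontr)
        assume "\<not> (y = 0 \<or> z = 0)"
        then have "y \<in> T" "z \<in> T"
          using key[of y z] key[of z y] that by (auto simp: add.commute)
        then show False using T(1) aT that(3) by (simp add: add_submonoid_def)
      qed
      then show "a \<in> ?I" using a AS a0 by blast
    qed
    show "?I \<subseteq> A"
    proof
      fix x assume x: "x \<in> ?I"
      let ?M = "{x \<in> S. x = 0 \<or> x \<in> A \<or> (\<exists>y\<in>S. \<exists>z\<in>S. y \<noteq> 0 \<and> z \<noteq> 0 \<and> x = y + z)}"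
      have "S \<subseteq> ?M"
        unfolding S[symmetric]
      proof (rule hull_minimal)
        show "add_submonoid {x \<in> add_submonoid hull A. x = 0 \<or> x \<in> A \<or>
            (\<exists>y\<in>add_submonoid hull A. \<exists>z\<in>add_submonoid hull A. y \<noteq> 0 \<and> z \<noteq> 0 \<and> x = y + z)}"
          unfolding S
        proof (unfold add_submonoid_def, intro conjI ballI)
          fix u v assume u: "u \<in> ?M" and v: "v \<in> ?M"
          then have "u + v \<in> S" using subS by (simp add: add_submonoid_def)
          then show "u + v \<in> ?M" using u v by (cases "u = 0"; cases "v = 0") auto
        qed (use subS in \<open>simp add: add_submonoid_def\<close>)
      qed (auto intro: hull_inc)
      then show "x \<in> A" using x by auto
    qed
  qed
qed

lemma minimal_generators_eq:
  assumes "minimal_generating_set A S"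
  shows "minimal_generators S = A"
  unfolding minimal_generators_def
  using assms minimal_generating_set_irreducibles by (metis (no_types, lifting) the_equality)


section \<open>Term orders and leading terms\<close>

definition term_order :: "(nat ^ 'd \<Rightarrow> nat ^ 'd \<Rightarrow> bool) \<Rightarrow> bool" where
  "term_order le \<longleftrightarrow>
     class.linorder le (\<lambda>a b. le a b \<and> a \<noteq> b) \<and>
     (\<forall>a b c. le a b \<longrightarrow> le (a + c) (b + c)) \<and> (\<forall>a. le 0 a)"

definition Frobenius_element :: "(nat ^ 'd \<Rightarrow> nat ^ 'd \<Rightarrow> bool) \<Rightarrow> (nat ^ 'd) set \<Rightarrow> nat ^ 'd" where
  "Frobenius_element le S = linorder.Max le (gaps S)"

text \<open>A polynomial with coefficients in \<open>'a\<close> is a finitely supported function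
  \<^typ>\<open>nat ^ 'd \<Rightarrow>\<^sub>0 'a\<close>, multiplied by convolution; \<open>Poly_Mapping.single a c\<close> is the term
  \<open>c t\<^sup>a\<close>.\<close>

definition leading_term ::
    "(nat ^ 'd \<Rightarrow> nat ^ 'd \<Rightarrow> bool) \<Rightarrow> (nat ^ 'd \<Rightarrow>\<^sub>0 'a::zero) \<Rightarrow> (nat ^ 'd \<Rightarrow>\<^sub>0 'a)" where
  "leading_term le f =
     (let b = linorder.Max le (Poly_Mapping.keys f)
      in Poly_Mapping.single b (Poly_Mapping.lookup f b))"

text \<open>The exponent of a nonzero term.\<close>

definition term_exponent :: "(nat ^ 'd \<Rightarrow>\<^sub>0 'a::zero) \<Rightarrow> nat ^ 'd" where
  "term_exponent m = the_elem (Poly_Mapping.keys m)"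


section \<open>The semigroup ring, its Hilbert series and its K-polynomial\<close>

definition poly_scale ::
    "'k::field \<Rightarrow> (nat ^ 'd \<Rightarrow>\<^sub>0 'k) \<Rightarrow> (nat ^ 'd \<Rightarrow>\<^sub>0 'k)" where
  "poly_scale c p = Poly_Mapping.single 0 c * p"

lemma vector_space_poly_scale: "vector_space poly_scale"
  by standard
     (simp_all add: poly_scale_def distrib_left distrib_right single_add mult_single
       flip: mult.assoc)

definition semigroup_ring :: "(nat ^ 'd) set \<Rightarrow> (nat ^ 'd \<Rightarrow>\<^sub>0 'k::field) set" where
  "semigroup_ring S = module.span poly_scale ((\<lambda>s. Poly_Mapping.single s 1) ` S)"

definition semigroup_ring_component ::
    "(nat ^ 'd) set \<Rightarrow> nat ^ 'd \<Rightarrow> (nat ^ 'd \<Rightarrow>\<^sub>0 'k::field) set" where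
  "semigroup_ring_component S s = {p \<in> semigroup_ring S. Poly_Mapping.keys p \<subseteq> {s}}"

text \<open>A formal power series over \<^typ>\<open>int\<close> is its coefficient function
  \<^typ>\<open>nat ^ 'd \<Rightarrow> int\<close>.\<close>

definition Hilbert_series :: "'k::field itself \<Rightarrow> (nat ^ 'd) set \<Rightarrow> nat ^ 'd \<Rightarrow> int" where
  "Hilbert_series _ S s =
     (if s \<in> S
      then int (vector_space.dim poly_scale
             (semigroup_ring_component S s :: (nat ^ 'd \<Rightarrow>\<^sub>0 'k) set))
      else 0)"

text \<open>The sum is finite, as an exponent has only finitely many decompositions.\<close>

definition series_mult :: "(nat ^ 'd \<Rightarrow> int) \<Rightarrow> (nat ^ 'd \<Rightarrow> int) \<Rightarrow> nat ^ 'd \<Rightarrow> int" where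
  "series_mult f g x = (\<Sum>(y, z) \<in> {(y, z). y + z = x}. f y * g z)"

text \<open>The quotient representation \<open>H = K / \<Prod>(1 - t\<^sup>a)\<close> is expressed by
  \<open>K = H \<cdot> \<Prod>(1 - t\<^sup>a)\<close> in the ring of formal power series, in which the denominator is
  invertible.\<close>

definition K_polynomial :: "'k::field itself \<Rightarrow> (nat ^ 'd) set \<Rightarrow> (nat ^ 'd \<Rightarrow>\<^sub>0 int)" where
  "K_polynomial k S =
     (THE K. Poly_Mapping.lookup K =
        series_mult (Hilbert_series k S)
          (Poly_Mapping.lookup (\<Prod>a\<in>minimal_generators S. 1 - Poly_Mapping.single a 1)))"

end

theory Submission
  imports Defs
begin

text \<open>
  As the cone is the whole orthant, the Hilbert series is the all-ones series minus
  \<open>G = \<Sum>h\<in>gaps S. t\<^sup>h\<close>, so with \<open>P = \<Prod>a\<in>A. 1 - t\<^sup>a\<close> the K-polynomial is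
  \<open>Q - G * P\<close>, where \<open>Q\<close> is \<open>P\<close> times the all-ones series. The cone hypothesis also
  puts a generator on every coordinate axis, so every \<open>1 - t\<^sub>i\<close> divides its own factor of \<open>P\<close>;
  hence \<open>Q\<close> is a polynomial all of whose exponents are strictly below \<open>\<Sum>A\<close> in each coordinate. For any
  term order these are smaller than the leading exponent \<open>F + \<Sum>A\<close> of \<open>G * P\<close>.
\<close>

lemma finite_vec_atMost: "finite {y :: nat ^ 'd. \<forall>i. y $ i \<le> x $ i}"
proof -
  have "{y :: nat ^ 'd. \<forall>i. y $ i \<le> x $ i} \<subseteq> vec_lambda ` (PiE UNIV (\<lambda>i. {..x $ i}))"
    by (auto intro!: image_eqI[of _ _ "vec_nth _"])
  then show ?thesis
    by (rule finite_subset) (intro finite_imageI finite_PiE; simp)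
qed

lemma vec_nat_add_diff:
  fixes x y :: "nat ^ 'd"
  assumes "\<And>i. y $ i \<le> x $ i"
  shows "y + (x - y) = x"
  using assms by (simp add: vec_eq_iff)

lemma series_mult_altdef:
  "series_mult f g x = (\<Sum>z \<in> {z. \<forall>i. z $ i \<le> x $ i}. f (x - z) * g z)"
  unfolding series_mult_def
proof (rule sum.reindex_bij_witness[of _ "\<lambda>z. (x - z, z)" snd])
  fix z assume "z \<in> {z. \<forall>i. z $ i \<le> x $ i}"
  then show "(x - z, z) \<in> {(y, z). y + z = x}"
    using vec_nat_add_diff[of z x] by (simp add: add.commute)
qed auto

text \<open>Identifies \<open>series_mult\<close> with the convolution of polynomials, so that facts
  about series products apply to \<open>G * P\<close> and to the factors of
  \<open>P\<close>.\<close>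

lemma lookup_times_altdef:
  fixes p q :: "nat ^ 'd \<Rightarrow>\<^sub>0 int"
  shows "Poly_Mapping.lookup (p * q) = series_mult (Poly_Mapping.lookup p) (Poly_Mapping.lookup q)"
proof
  fix x
  have inner: "(\<Sum>v. Poly_Mapping.lookup q v when x = y + v) =
      (if \<forall>i. y $ i \<le> x $ i then Poly_Mapping.lookup q (x - y) else 0)" for y
  proof (cases "\<forall>i. y $ i \<le> x $ i")
    case True
    then have "x = y + v \<longleftrightarrow> v = x - y" for v
      by (auto simp: vec_eq_iff)
    then show ?thesis using True by (simp add: when_def)
  next
    case False
    then have "x \<noteq> y + v" for v by auto
    then have "(\<Sum>v. Poly_Mapping.lookup q v when x = y + v) = 0" by simp
    then show ?thesis unfolding if_not_P[OF False] .
  qed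
  have "Poly_Mapping.lookup (p * q) x = (\<Sum>y. Poly_Mapping.lookup p y *
      (if \<forall>i. y $ i \<le> x $ i then Poly_Mapping.lookup q (x - y) else 0))"
    by (simp add: lookup_mult inner)
  also have "\<dots> = (\<Sum>y \<in> {y. \<forall>i. y $ i \<le> x $ i}. Poly_Mapping.lookup p y *
      (if \<forall>i. y $ i \<le> x $ i then Poly_Mapping.lookup q (x - y) else 0))"
    by (rule Sum_any.expand_superset[OF finite_vec_atMost]) auto
  \<comment> \<open>Reflecting the box by \<open>x - z\<close> swaps the two factors; truncated
    subtraction is involutive there, as \<open>z\<close> is componentwise below
    \<open>x\<close>.\<close>
  also have "\<dots> = (\<Sum>z \<in> {z. \<forall>i. z $ i \<le> x $ i}.
      Poly_Mapping.lookup p (x - z) * Poly_Mapping.lookup q z)"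
  proof (rule sum.reindex_bij_witness[of _ "\<lambda>z. x - z" "\<lambda>z. x - z"])
    fix z assume "z \<in> {z. \<forall>i. z $ i \<le> x $ i}"
    then show "x - (x - z) = z" by (simp add: vec_eq_iff)
    then show "Poly_Mapping.lookup p (x - (x - z)) * Poly_Mapping.lookup q (x - z) =
        Poly_Mapping.lookup p z *
        (if \<forall>i. z $ i \<le> x $ i then Poly_Mapping.lookup q (x - z) else 0)"
      using \<open>z \<in> _\<close> by simp
  qed (auto simp: vec_eq_iff)
  finally show "Poly_Mapping.lookup (p * q) x =
      series_mult (Poly_Mapping.lookup p) (Poly_Mapping.lookup q) x"
    by (simp add: series_mult_altdef)
qed

text \<open>For \<open>s\<close> in \<open>S\<close> the component is the line spanned by the
  monomial of exponent \<open>s\<close>, hence of dimension 1 over every field.\<close>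

lemma Hilbert_series_eq_indicator:
  fixes S :: "(nat ^ 'd) set"
  shows "Hilbert_series TYPE('k::field) S = (\<lambda>s. if s \<in> S then 1 else 0)"
proof
  fix s :: "nat ^ 'd"
  interpret vs: vector_space "poly_scale :: 'k \<Rightarrow> (nat ^ 'd \<Rightarrow>\<^sub>0 'k) \<Rightarrow> _"
    by (rule vector_space_poly_scale)
  let ?t = "Poly_Mapping.single s 1 :: nat ^ 'd \<Rightarrow>\<^sub>0 'k"
  show "Hilbert_series TYPE('k) S s = (if s \<in> S then 1 else 0)"
  proof (cases "s \<in> S")
    case True
    have "(semigroup_ring_component S s :: (nat ^ 'd \<Rightarrow>\<^sub>0 'k) set) = vs.span {?t}"
    proof
      show "semigroup_ring_component S s \<subseteq> vs.span {?t}"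
      proof
        fix p :: "nat ^ 'd \<Rightarrow>\<^sub>0 'k" assume "p \<in> semigroup_ring_component S s"
        then have "Poly_Mapping.keys p \<subseteq> {s}" by (simp add: semigroup_ring_component_def)
        then have "p = poly_scale (Poly_Mapping.lookup p s) ?t"
          by (intro poly_mapping_eqI)
             (auto simp: poly_scale_def mult_single lookup_single when_def in_keys_iff)
        then show "p \<in> vs.span {?t}"
          by (metis vs.span_base vs.span_scale singletonI)
      qed
      have "?t \<in> semigroup_ring S"
        unfolding semigroup_ring_def using True by (intro vs.span_base) auto
      then have "vs.span {?t} \<subseteq> semigroup_ring S"
        by (simp add: semigroup_ring_def vs.span_minimal)
      moreover have "Poly_Mapping.keys p \<subseteq> {s}" if "p \<in> vs.span {?t}" for p
        using that by (auto simp: vs.span_singleton poly_scale_def mult_single in_keys_iff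
            lookup_single when_def split: if_splits)
      ultimately show "vs.span {?t} \<subseteq> semigroup_ring_component S s"
        by (auto simp: semigroup_ring_component_def)
    qed
    moreover have "vs.dim (vs.span {?t}) = 1"
    proof -
      have "?t \<noteq> 0" by (metis lookup_single_eq lookup_zero zero_neq_one)
      then have "vs.independent {?t}" by simp
      then show ?thesis using vs.dim_span_eq_card_independent[of "{?t}"] by simp
    qed
    ultimately show ?thesis using True by (simp add: Hilbert_series_def)
  qed (simp add: Hilbert_series_def)
qed

text \<open>A relational form of the leading exponent, meaningful also for power series, whose
  support may have no maximum.\<close>

definition leads :: "('b \<Rightarrow> 'b \<Rightarrow> bool) \<Rightarrow> ('b \<Rightarrow> int) \<Rightarrow> 'b \<Rightarrow> bool" where
  "leads le f b \<longleftrightarrow> f b \<noteq> 0 \<and> (\<forall>x. f x \<noteq> 0 \<longrightarrow> le x b)"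

lemma term_order_le_of_componentwise:
  fixes x y :: "nat ^ 'd"
  assumes "term_order le" "\<And>i. x $ i \<le> y $ i"
  shows "le x y"
proof -
  have "le (0 + x) ((y - x) + x)" using assms(1) unfolding term_order_def by blast
  then show ?thesis using vec_nat_add_diff[of x y] assms(2) by (simp add: add.commute)
qed

text \<open>By strict monotonicity of addition, \<open>(a, b)\<close> is the only pair of exponents
  of \<open>f\<close> and \<open>g\<close> with sum \<open>a + b\<close>; the coefficient there is
  \<open>f a * g b\<close>, nonzero in the integers.\<close>

lemma leads_series_mult:
  assumes "term_order le" "leads le f a" "leads le g b"
  shows "leads le (series_mult f g) (a + b)"
proof -
  interpret lo: linorder le "\<lambda>a b. le a b \<and> a \<noteq> b"
    using assms(1) by (simp add: term_order_def)
  have add: "le (y + z) (a + b)" if "le y a" "le z b" for y z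
    using assms(1) that unfolding term_order_def by (metis add.commute lo.order_trans)
  have eq: "y = a \<and> z = b" if "le y a" "le z b" "y + z = a + b" for y z
  proof -
    have "le (y + z) (a + z)" "le (a + z) (a + b)"
      using assms(1) that unfolding term_order_def by (metis add.commute)+
    then have "y + z = a + z" "a + z = a + b" using that by (metis lo.order_antisym)+
    then show ?thesis by simp
  qed
  let ?D = "{(y, z). y + z = a + b}"
  have fin: "finite ?D"
  proof (rule finite_subset)
    show "?D \<subseteq> {y. \<forall>i. y $ i \<le> (a + b) $ i} \<times> {y. \<forall>i. y $ i \<le> (a + b) $ i}"
      by (auto simp: vec_eq_iff) (metis le_add1 le_add2)+
  qed (intro finite_cartesian_product finite_vec_atMost)
  have "series_mult f g (a + b) = (\<Sum>(y, z)\<in>{(a, b)}. f y * g z)"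
    unfolding series_mult_def
  proof (rule sum.mono_neutral_right[OF fin])
    show "\<forall>yz\<in>?D - {(a, b)}. (case yz of (y, z) \<Rightarrow> f y * g z) = 0"
      using assms(2,3) eq unfolding leads_def by fastforce
  qed auto
  moreover have "le x (a + b)" if x: "series_mult f g x \<noteq> 0" for x
  proof -
    obtain yz where "yz \<in> {(y, z). y + z = x}" "(case yz of (y, z) \<Rightarrow> f y * g z) \<noteq> 0"
      using x unfolding series_mult_def by (rule sum.not_neutral_contains_not_neutral)
    then show ?thesis using add assms(2,3) unfolding leads_def by auto
  qed
  ultimately show ?thesis using assms(2,3) unfolding leads_def by auto
qed

text \<open>A term order puts 0 below every \<open>a\<close>, so each factor has leading exponent
  \<open>a\<close>, and these add up. A factor with \<open>a = 0\<close> would be the zero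
  polynomial.\<close>

lemma leads_prod_one_minus:
  assumes "term_order le" "finite A" "0 \<notin> A"
  shows "leads le (Poly_Mapping.lookup (\<Prod>a\<in>A. 1 - Poly_Mapping.single a 1)) (\<Sum>A)"
  using assms(2,3)
proof (induction A rule: finite_induct)
  case empty
  then show ?case
    using assms(1) by (auto simp: leads_def term_order_def lookup_one when_def)
next
  case (insert a A)
  interpret lo: linorder le "\<lambda>a b. le a b \<and> a \<noteq> b"
    using assms(1) by (simp add: term_order_def)
  have "leads le (Poly_Mapping.lookup (1 - Poly_Mapping.single a 1)) a"
    using assms(1) insert.prems
    by (auto simp: leads_def term_order_def lookup_one lookup_minus lookup_single when_def)
  then show ?case
    using leads_series_mult[OF assms(1)] insert by (simp add: lookup_times_altdef)
qed

text \<open>Each factor contributes \<open>0\<close> or \<open>a\<close>, so every exponent of the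
  product is the sum of a subset of \<open>A\<close>.\<close>

lemma exponent_prod_one_minus_le:
  fixes z :: "nat ^ 'd"
  assumes "finite A"
    and "Poly_Mapping.lookup (\<Prod>a\<in>A. 1 - Poly_Mapping.single a (1::int)) z \<noteq> 0"
  shows "z $ i \<le> (\<Sum>A) $ i"
  using assms
proof (induction A arbitrary: z rule: finite_induct)
  case empty
  then show ?case by (auto simp: lookup_one when_def split: if_splits)
next
  case (insert a A)
  have "z \<in> Poly_Mapping.keys ((1 - Poly_Mapping.single a 1) *
      (\<Prod>a\<in>A. 1 - Poly_Mapping.single a (1::int)))"
    using insert by (simp add: in_keys_iff)
  then obtain u v where uv: "z = u + v" "u \<in> Poly_Mapping.keys (1 - Poly_Mapping.single a (1::int))"
    "v \<in> Poly_Mapping.keys (\<Prod>a\<in>A. 1 - Poly_Mapping.single a (1::int))"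
    using keys_mult by blast
  have "u $ i \<le> a $ i"
    using uv(2) by (auto simp: in_keys_iff lookup_one lookup_minus lookup_single when_def
        split: if_splits)
  moreover have "v $ i \<le> (\<Sum>A) $ i"
    using uv(3) insert.IH by (simp add: in_keys_iff)
  ultimately show ?case using uv(1) insert by simp
qed

text \<open>Multiplying \<open>\<Prod>a\<in>A. 1 - t\<^sup>a\<close> by the all-ones series sums the coefficients below \<open>x\<close>; the
  factor of a generator on the \<open>i\<close>-th axis makes these sums telescope to zero for large \<open>x $ i\<close>.\<close>

lemma series_mult_ones_prod_eq_0:
  fixes x :: "nat ^ 'd"
  assumes fin: "finite A" and m: "m \<in> A" "\<And>j. j \<noteq> i \<Longrightarrow> m $ j = 0"
    and x: "(\<Sum>A) $ i \<le> x $ i"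
  shows "series_mult (\<lambda>_. 1)
    (Poly_Mapping.lookup (\<Prod>a\<in>A. 1 - Poly_Mapping.single a 1)) x = 0"
proof -
  let ?P = "\<Prod>a\<in>A - {m}. 1 - Poly_Mapping.single a (1::int)"
  let ?L = "\<lambda>x :: nat ^ 'd. {z. \<forall>j. z $ j \<le> x $ j}"
  have sumA: "(\<Sum>A) $ i = m $ i + (\<Sum>(A - {m})) $ i"
    using fin m(1) by (simp add: sum.remove[of A m "\<lambda>a. a"])
  \<comment> \<open>Off the axis \<open>m\<close> vanishes; on it, \<open>m $ i\<close> is one
    summand of \<open>(\<Sum>A) $ i\<close>.\<close>
  have mx: "m $ j \<le> x $ j" for j
    using m(2)[of j] x sumA by (cases "j = i") auto
  have shift: "Poly_Mapping.lookup (Poly_Mapping.single m 1 * ?P) z =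
      (if \<forall>j. m $ j \<le> z $ j then Poly_Mapping.lookup ?P (z - m) else 0)" for z
  proof -
    have "Poly_Mapping.lookup (?P * Poly_Mapping.single m 1) z =
        (\<Sum>w\<in>?L z. if w = m then Poly_Mapping.lookup ?P (z - m) else 0)"
      unfolding lookup_times_altdef series_mult_altdef
      by (intro sum.cong) (auto simp: lookup_single when_def)
    then show ?thesis by (simp add: finite_vec_atMost mult.commute)
  qed
  have "(\<Sum>z\<in>?L x. Poly_Mapping.lookup (Poly_Mapping.single m 1 * ?P) z) =
      (\<Sum>z\<in>{z \<in> ?L x. \<forall>j. m $ j \<le> z $ j}. Poly_Mapping.lookup ?P (z - m))"
    by (rule sum.mono_neutral_cong_right[OF finite_vec_atMost]) (auto simp: shift)
  also have "\<dots> = (\<Sum>z\<in>?L (x - m). Poly_Mapping.lookup ?P z)"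
  proof (rule sum.reindex_bij_witness[of _ "\<lambda>z. z + m" "\<lambda>z. z - m"])
    fix z assume "z \<in> {z \<in> ?L x. \<forall>j. m $ j \<le> z $ j}"
    then show "z - m + m = z" "z - m \<in> ?L (x - m)"
      by (simp_all add: vec_eq_iff diff_le_mono)
  next
    fix z assume "z \<in> ?L (x - m)"
    then show "z + m \<in> {z \<in> ?L x. \<forall>j. m $ j \<le> z $ j}"
      using mx by (simp add: le_diff_conv2)
  qed simp_all
  \<comment> \<open>A point only in the larger box has \<open>z $ i > x $ i - m $ i\<close>, which
    is at least \<open>(\<Sum>(A - {m})) $ i\<close>; so it is no exponent of
    \<open>?P\<close>.\<close>
  also have "\<dots> = (\<Sum>z\<in>?L x. Poly_Mapping.lookup ?P z)"
  proof (rule sum.mono_neutral_left[OF finite_vec_atMost])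
    show "?L (x - m) \<subseteq> ?L x" by (auto intro: order.trans)
    show "\<forall>z\<in>?L x - ?L (x - m). Poly_Mapping.lookup ?P z = 0"
    proof (rule ballI, rule ccontr)
      fix z assume z: "z \<in> ?L x - ?L (x - m)" and nz: "Poly_Mapping.lookup ?P z \<noteq> 0"
      have "z $ i \<le> (\<Sum>(A - {m})) $ i"
        using exponent_prod_one_minus_le[OF _ nz] fin by blast
      then have "z $ i \<le> x $ i - m $ i" using x sumA by linarith
      then have "z $ j \<le> (x - m) $ j" for j
        using z m(2)[of j] by (cases "j = i") auto
      then show False using z by blast
    qed
  qed
  finally have "(\<Sum>z\<in>?L x. Poly_Mapping.lookup ((1 - Poly_Mapping.single m 1) * ?P) z) = 0"
    by (simp add: left_diff_distrib lookup_minus sum_subtractf)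
  then show ?thesis
    using prod.remove[OF fin m(1), of "\<lambda>a. 1 - Poly_Mapping.single a (1::int)"]
    by (simp add: series_mult_altdef)
qed

text \<open>The unit vector on the axis is a nonnegative combination of generators. Nothing cancels,
  so generators with positive coefficient vanish off the axis.\<close>

lemma axis_generator:
  fixes S :: "(nat ^ 'd) set"
  assumes A: "minimal_generating_set A S"
    and cone: "rat_cone S \<inter> range of_nat_vec = range of_nat_vec"
  obtains m where "m \<in> A" "m $ i > 0" "\<And>j. j \<noteq> i \<Longrightarrow> m $ j = 0"
proof -
  let ?e = "axis i 1 :: nat ^ 'd"
  have "of_nat_vec ?e \<in> rat_cone S" using cone by blast
  then obtain l where l: "of_nat_vec ?e = (\<Sum>a\<in>A. l a *s (of_nat_vec a :: rat ^ 'd))"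
    and nn: "\<And>a. a \<in> A \<Longrightarrow> 0 \<le> l a"
    unfolding rat_cone_def minimal_generators_eq[OF A] by blast
  have fin: "finite A" using A by (simp add: minimal_generating_set_def)
  have comp: "of_nat (?e $ j) = (\<Sum>a\<in>A. l a * of_nat (a $ j))" for j
    using arg_cong[OF l, of "\<lambda>v. v $ j"] by (simp add: of_nat_vec_def)
  have "(\<Sum>a\<in>A. l a * of_nat (a $ i)) \<noteq> 0" using comp[of i] by simp
  then obtain m where m: "m \<in> A" "l m * of_nat (m $ i) \<noteq> 0"
    by (rule sum.not_neutral_contains_not_neutral)
  have "m $ j = 0" if "j \<noteq> i" for j
  proof -
    have "(\<Sum>a\<in>A. l a * of_nat (a $ j)) = 0" using comp[of j] that by (simp add: axis_def)
    then have "l m * of_nat (m $ j) = 0"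
      using sum_nonneg_eq_0_iff[OF fin, of "\<lambda>a. l a * of_nat (a $ j)"] nn m(1) by simp
    then show ?thesis using m(2) by simp
  qed
  then show ?thesis using that m by auto
qed

lemma term_exponent_leading_term:
  assumes "term_order le" "leads le (Poly_Mapping.lookup p) b"
  shows "term_exponent (leading_term le p) = b"
proof -
  interpret lo: linorder le "\<lambda>a b. le a b \<and> a \<noteq> b"
    using assms(1) by (simp add: term_order_def)
  have "lo.Max (Poly_Mapping.keys p) = b"
    using assms(2) by (intro lo.Max_eqI) (auto simp: leads_def in_keys_iff)
  then show ?thesis
    using assms(2) by (simp add: leading_term_def term_exponent_def leads_def)
qed

theorem theorem4p2:
  fixes S A :: "(nat ^ 'd) set"
    and le :: "nat ^ 'd \<Rightarrow> nat ^ 'd \<Rightarrow> bool"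
  assumes "C_semigroup S"
    and "minimal_generating_set A S"
    and "rat_cone S \<inter> range of_nat_vec = range of_nat_vec"
    and "term_order le"
  shows "(of_nat_vec (Frobenius_element le S) :: int ^ 'd) =
    of_nat_vec (term_exponent (leading_term le (K_polynomial TYPE('k::field) S)))
      - (\<Sum>a\<in>A. of_nat_vec a)"
proof -
  interpret lo: linorder le "\<lambda>a b. le a b \<and> a \<noteq> b"
    using assms(4) by (simp add: term_order_def)
  define P where "P = (\<Prod>a\<in>A. 1 - Poly_Mapping.single a (1::int))"
  define G where "G = (\<Sum>h\<in>gaps S. Poly_Mapping.single h (1::int))"
  define F where "F = Frobenius_element le S"
  let ?Q = "series_mult (\<lambda>_. 1) (Poly_Mapping.lookup P)"
  let ?K = "series_mult (Hilbert_series TYPE('k) S) (Poly_Mapping.lookup P)"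
  have finA: "finite A" using assms(2) by (simp add: minimal_generating_set_def)
  have A0: "0 \<notin> A" using minimal_generating_set_irreducibles[OF assms(2)] by blast
  have gaps: "finite (gaps S)" "gaps S \<noteq> {}" using assms(1) by (auto simp: C_semigroup_def)
  have gaps_eq: "gaps S = - S" using assms(3) by (auto simp: gaps_def)
  have G: "Poly_Mapping.lookup G x = (if x \<in> S then 0 else 1)" for x
    using gaps(1) gaps_eq by (simp add: G_def lookup_sum lookup_single when_def)
  \<comment> \<open>The indicator of \<open>S\<close> is the all-ones series minus
    \<open>G\<close>.\<close>
  have K: "?K x = ?Q x - Poly_Mapping.lookup (G * P) x" for x
    unfolding lookup_times_altdef series_mult_altdef Hilbert_series_eq_indicator G
      sum_subtractf[symmetric]
    by (intro sum.cong) auto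
  have Q0: "x $ i < (\<Sum>A) $ i" if "?Q x \<noteq> 0" for x i
    using axis_generator[OF assms(2,3), of i] series_mult_ones_prod_eq_0[OF finA] that
    unfolding P_def by (metis not_le)
  \<comment> \<open>\<open>?Q\<close> lives in the box below \<open>\<Sum>A\<close> and
    \<open>G * P\<close> is a polynomial, so \<open>?K\<close> has finite support and defines a
    polynomial.\<close>
  have "finite {x. ?Q x \<noteq> 0}"
    by (rule finite_subset[OF _ finite_vec_atMost[of "\<Sum>A"]]) (use Q0 less_imp_le in blast)
  then have finK: "finite {x. ?K x \<noteq> 0}"
    by (rule finite_subset[rotated, OF finite_UnI[OF _ finite_lookup[of "G * P"]]]) (auto simp: K)
  have K_poly: "Poly_Mapping.lookup (K_polynomial TYPE('k) S) = ?K"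
    unfolding K_polynomial_def minimal_generators_eq[OF assms(2)] P_def[symmetric]
  proof (rule theI)
    show "Poly_Mapping.lookup (Poly_Mapping.Abs_poly_mapping ?K) = ?K"
      using finK by simp
  qed (use finK in \<open>auto intro!: poly_mapping_eqI\<close>)
  have "leads le (Poly_Mapping.lookup G) F"
    using lo.Max_in[OF gaps] lo.Max_ge[OF gaps(1)] gaps_eq
    by (auto simp: leads_def G F_def Frobenius_element_def)
  then have GP: "leads le (Poly_Mapping.lookup (G * P)) (F + \<Sum>A)"
    unfolding lookup_times_altdef P_def
    by (intro leads_series_mult leads_prod_one_minus assms(4) finA A0)
  \<comment> \<open>No coordinate of \<open>F + \<Sum>A\<close> is below that of
    \<open>\<Sum>A\<close>, so the strict bound \<open>Q0\<close> fails at any index.\<close>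
  have "?Q (F + \<Sum>A) = 0" using Q0[of "F + \<Sum>A"] by (force simp only: vector_add_component)
  moreover have "le x (F + \<Sum>A)" if "?Q x \<noteq> 0" for x
  proof (rule term_order_le_of_componentwise[OF assms(4)])
    show "x $ i \<le> (F + \<Sum>A) $ i" for i
      using Q0[OF that, of i] by (simp only: vector_add_component)
  qed
  \<comment> \<open>The coefficient of \<open>?K\<close> at \<open>F + \<Sum>A\<close> is minus that
    of \<open>G * P\<close>, hence nonzero; every exponent of \<open>?K\<close> comes from
    \<open>?Q\<close> or \<open>G * P\<close>.\<close>
  ultimately have "leads le ?K (F + \<Sum>A)"
    using GP unfolding leads_def K
    by (metis cancel_comm_monoid_add_class.diff_cancel diff_0 neg_equal_0_iff_equal)
  then have "term_exponent (leading_term le (K_polynomial TYPE('k) S)) = F + \<Sum>A"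
    by (intro term_exponent_leading_term assms(4)) (simp add: K_poly)
  then show ?thesis
    by (simp add: F_def of_nat_vec_def vec_eq_iff)
qed

end
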